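(* Let $n$ be any composite positive integer. Then the following are equivalent: (i) $n$ is a Giuga number. (ii) For every positive integer $K$, $\sum_{j=1}^{n-1} j^{K\lambda(n)} \equiv \sum_{j=1}^{n-1} j^{K\phi(n)} \equiv -1 \pmod n$. (iii) There exists a positive integer $K$ such that $\sum_{j=1}^{n-1} j^{K\lambda(n)} \equiv \sum_{j=1}^{n-1} j^{K\phi(n)} \equiv -1 \pmod n$.
   Context: $\phi$ is Euler's totient function and $\lambda$ is the Carmichael function: $\lambda(n)$ is the exponent of the group $(\mathbb{Z}/n\mathbb{Z})^\times$. A Giuga number is a composite positive integer $n$ such that $p \mid (n/p - 1)$ for every prime divisor $p$ of $n$. *)

theory Defs
  imports "HOL-Number_Theory.Number_Theory" "HOL-Number_Theory.Residue_Primitive_Roots"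
begin

definition composite :: "nat \<Rightarrow> bool" where
  "composite n \<longleftrightarrow> n > 1 \<and> \<not> prime n"

definition giuga_number :: "nat \<Rightarrow> bool" where
  "giuga_number n \<longleftrightarrow>
     composite n \<and> (\<forall>p. prime p \<and> p dvd n \<longrightarrow> int p dvd int (n div p) - 1)"

text \<open>The library's \<^const>\<open>Carmichael\<close> is the LCM of the orders of the units modulo \<open>n\<close>,
  that is, the exponent of the unit group of the integers modulo \<open>n\<close>.\<close>

definition giuga_congruences :: "nat \<Rightarrow> nat \<Rightarrow> bool" where
  "giuga_congruences n K \<longleftrightarrow>
     [(\<Sum>j=1..n-1. int j ^ (K * Carmichael n)) = (\<Sum>j=1..n-1. int j ^ (K * totient n))] (mod int n) \<and>
     [(\<Sum>j=1..n-1. int j ^ (K * totient n)) = - 1] (mod int n)"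

end

theory Submission
  imports Defs "HOL-Computational_Algebra.Squarefree"
begin

text \<open>For a prime \<open>p\<close> dividing \<open>n\<close>, both \<open>\<lambda>(n)\<close> and \<open>\<phi>(n)\<close> are multiples of \<open>p - 1\<close>, so by Fermat
  every block of \<open>p\<close> consecutive summands contributes \<open>-1\<close> modulo \<open>p\<close> and each of the two power
  sums is \<open>-n/p\<close> modulo \<open>p\<close>. Hence the power sums are \<open>-1\<close> modulo every prime divisor of \<open>n\<close> iff
  \<open>n\<close> satisfies the Giuga condition, and that condition forces \<open>n\<close> to be squarefree, so that the
  congruences modulo the primes combine to one modulo \<open>n\<close>.\<close>

text \<open>For odd \<open>p\<close>, split off the full power \<open>p ^ k\<close> of
  \<open>p\<close> in \<open>n\<close>: \<open>Carmichael (p ^ k)\<close> has the factor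
  \<open>p - 1\<close> and divides \<open>Carmichael n\<close>, the cofactor being coprime to
  \<open>p\<close>. The prime 2 is separate because the formula for odd prime powers does not cover
  it, but there \<open>p - 1\<close> is 1.\<close>

lemma Carmichael_prime_dvd:
  assumes "prime p" "p dvd n" "n > 0"
  shows "p - 1 dvd Carmichael n"
proof (cases "p = 2")
  case False
  then have "odd p"
    using assms(1) primes_dvd_imp_eq two_is_prime_nat by blast
  define k where "k = multiplicity p n"
  obtain m where m: "n = p ^ k * m" "\<not> p dvd m"
    using multiplicity_decompose'[of n p] assms unfolding k_def
    by (metis not_prime_unit gr_implies_not0)
  have "k > 0"
    using m assms(2) by (auto intro!: Nat.gr0I)
  have "coprime (p ^ k) m"
    using m(2) assms(1) by (simp add: prime_imp_coprime)
  moreover have "p ^ k > 1"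
    using \<open>k > 0\<close> assms(1) by (metis one_less_power prime_gt_1_nat)
  moreover have "m > 0"
    using m(1) assms(3) by (auto intro!: Nat.gr0I)
  ultimately have "Carmichael (p ^ k) dvd Carmichael n"
    unfolding m(1) by (cases "m = 1") (auto intro!: Carmichael_dvd_mono_coprime)
  moreover have "Carmichael (p ^ k) = p ^ (k - 1) * (p - 1)"
    using assms(1) \<open>odd p\<close> \<open>k > 0\<close> Carmichael_odd_prime_power by blast
  ultimately show ?thesis
    using dvd_trans dvd_triv_right by metis
qed auto

lemma cong_power_prime_multiple:
  assumes "prime p" "p - 1 dvd m" "\<not> p dvd j"
  shows "[int j ^ m = 1] (mod int p)"
proof -
  obtain c where c: "m = (p - 1) * c"
    using assms(2) by blast
  have "[(j ^ (p - 1)) ^ c = 1 ^ c] (mod p)"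
    using fermat_theorem[OF assms(1,3)] by (rule cong_pow)
  then have "[j ^ m = 1] (mod p)"
    by (simp add: c power_mult)
  then show ?thesis
    by (metis cong_int_iff of_nat_1 of_nat_power)
qed

lemma sum_power_prime_block:
  assumes "prime p" "p - 1 dvd m" "m > 0"
  shows "[(\<Sum>j=i*p..<i*p+p. int j ^ m) = - 1] (mod int p)"
proof -
  have "p > 0"
    using assms(1) prime_gt_0_nat by blast
  have "(\<Sum>j=i*p..<i*p+p. int j ^ m) = (\<Sum>j=0..<p. int (j + i * p) ^ m)"
    using sum.shift_bounds_nat_ivl[of "\<lambda>j. int j ^ m" 0 "i * p" p] by (simp add: add.commute)
  \<comment> \<open>Each block has exactly one multiple of \<open>p\<close>; it contributes 0 since
    \<open>m > 0\<close> excludes the value \<open>0 ^ 0 = 1\<close>. Fermat turns the other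
    \<open>p - 1\<close> terms into 1.\<close>
  also have "[\<dots> = (\<Sum>j=0..<p. if j = 0 then 0 else 1)] (mod int p)"
  proof (rule cong_sum)
    fix j assume j: "j \<in> {0..<p}"
    show "[int (j + i * p) ^ m = (if j = 0 then 0 else 1)] (mod int p)"
    proof (cases "j = 0")
      case True
      then show ?thesis
        using assms(3) by (simp add: cong_0_iff power_mult_distrib)
    next
      case False
      then have "\<not> p dvd j + i * p"
        using j by (auto dest: dvd_imp_le simp: dvd_add_left_iff)
      then show ?thesis
        using False cong_power_prime_multiple[OF assms(1,2), of "j + i * p"] by simp
    qed
  qed
  also have "(\<Sum>j=0..<p. if j = 0 then 0 else 1) = int p - 1"
    using \<open>p > 0\<close> by (simp add: sum.atLeast_Suc_lessThan)
  also have "[int p - 1 = - 1] (mod int p)"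
    by (simp add: cong_iff_dvd_diff)
  finally show ?thesis .
qed

lemma sum_power_cong_prime:
  assumes "prime p" "p dvd n" "p - 1 dvd m" "m > 0"
  shows "[(\<Sum>j=1..n-1. int j ^ m) = - int (n div p)] (mod int p)"
proof (cases "n = 0")
  case False
  \<comment> \<open>Adding the term at 0, which vanishes as \<open>m > 0\<close>, gives a range of
    \<open>n\<close> terms that splits into \<open>n div p\<close> full blocks.\<close>
  have "{..<n} = insert 0 {1..n-1}"
    using False by auto
  then have "(\<Sum>j=1..n-1. int j ^ m) = (\<Sum>j<n. int j ^ m)"
    using assms(4) by simp
  also have "\<dots> = (\<Sum>i<n div p. \<Sum>j=i*p..<i*p+p. int j ^ m)"
    using assms(2) by (simp add: sum.nat_group)
  also have "[\<dots> = (\<Sum>i<n div p. - 1)] (mod int p)"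
    by (intro cong_sum sum_power_prime_block assms)
  finally show ?thesis
    by simp
qed simp

text \<open>A squarefree \<open>n\<close> is the product of its distinct prime factors, and these
  are pairwise coprime.\<close>

lemma squarefree_prime_dvd_imp_dvd:
  fixes n :: nat
  assumes "squarefree n" "\<And>p. prime p \<Longrightarrow> p dvd n \<Longrightarrow> int p dvd x"
  shows "int n dvd x"
proof -
  have "n \<noteq> 0"
    using assms(1) by (metis not_squarefree_0)
  have "n = (\<Prod>p\<in>prime_factors n. p ^ multiplicity p n)"
    using \<open>n \<noteq> 0\<close> by (intro prime_factorization_nat) simp
  also have "\<dots> = (\<Prod>p\<in>prime_factors n. p)"
    using assms(1) squarefree_factorial_semiring'[OF \<open>n \<noteq> 0\<close>] by (intro prod.cong) auto
  finally have n: "n = (\<Prod>p\<in>prime_factors n. p)" .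
  \<comment> \<open>The absolute value moves the divisibility to the naturals, where
    \<open>coprime_cong_prod_nat\<close> applies.\<close>
  have "[nat \<bar>x\<bar> = 0] (mod (\<Prod>p\<in>prime_factors n. p))"
  proof (rule coprime_cong_prod_nat)
    fix p assume "p \<in> prime_factors n"
    then show "[nat \<bar>x\<bar> = 0] (mod p)"
      using assms(2)[of p] by (auto simp: in_prime_factors_iff cong_0_iff)
  qed (auto simp: in_prime_factors_iff primes_coprime)
  then show ?thesis
    using n by (simp add: cong_0_iff)
qed

text \<open>If \<open>p ^ 2\<close> divided \<open>n\<close>, then \<open>p\<close> would divide
  both \<open>n div p\<close> and its predecessor, hence 1.\<close>

lemma squarefree_giuga_number:
  assumes "giuga_number n"
  shows "squarefree n"
proof -
  have "n > 1" and giuga: "\<And>p. prime p \<Longrightarrow> p dvd n \<Longrightarrow> int p dvd int (n div p) - 1"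
    using assms by (auto simp: giuga_number_def composite_def)
  have "\<not> p ^ 2 dvd n" if p: "prime p" for p
  proof
    assume "p ^ 2 dvd n"
    then obtain c where c: "n = p * (p * c)"
      by (metis dvdE mult.assoc power2_eq_square)
    then have "int p dvd int (p * c) - 1"
      using giuga[OF p] prime_gt_0_nat[OF p] by simp
    then have "int p dvd 1"
      by (metis dvd_diff_right_iff dvd_triv_left of_nat_mult dvd_diffD)
    then show False
      using p by simp
  qed
  then show ?thesis
    using \<open>n > 1\<close> by (auto simp: squarefree_factorial_semiring)
qed

lemma giuga_condition_iff_sum_power_cong:
  assumes "prime p" "p dvd n" "p - 1 dvd m" "m > 0"
  shows "int p dvd int (n div p) - 1 \<longleftrightarrow> [(\<Sum>j=1..n-1. int j ^ m) = - 1] (mod int p)"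
proof -
  have "[(\<Sum>j=1..n-1. int j ^ m) = - 1] (mod int p) \<longleftrightarrow> [- int (n div p) = - 1] (mod int p)"
    using sum_power_cong_prime[OF assms] by (meson cong_sym cong_trans)
  then show ?thesis
    by (simp add: cong_iff_dvd_diff dvd_diff_commute)
qed

text \<open>The exponent \<open>m\<close> is kept general so that the multiples of
  \<open>Carmichael n\<close> and of \<open>totient n\<close> are treated alike. Only the forward
  direction has to combine primes, and there the Giuga property itself supplies
  squarefreeness.\<close>

lemma giuga_number_iff_sum_power_cong:
  assumes "composite n" "m > 0" "\<And>p. prime p \<Longrightarrow> p dvd n \<Longrightarrow> p - 1 dvd m"
  shows "giuga_number n \<longleftrightarrow> [(\<Sum>j=1..n-1. int j ^ m) = - 1] (mod int n)"
proof
  assume giuga: "giuga_number n"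
  show "[(\<Sum>j=1..n-1. int j ^ m) = - 1] (mod int n)"
    unfolding cong_iff_dvd_diff
  proof (rule squarefree_prime_dvd_imp_dvd[OF squarefree_giuga_number[OF giuga]])
    fix p assume "prime p" "p dvd n"
    then show "int p dvd (\<Sum>j=1..n-1. int j ^ m) - - 1"
      using giuga giuga_condition_iff_sum_power_cong assms
      unfolding giuga_number_def cong_iff_dvd_diff by blast
  qed
next
  assume "[(\<Sum>j=1..n-1. int j ^ m) = - 1] (mod int n)"
  then have "[(\<Sum>j=1..n-1. int j ^ m) = - 1] (mod int p)" if "p dvd n" for p
    using that by (meson cong_dvd_modulus int_dvd_int_iff)
  then show "giuga_number n"
    using giuga_condition_iff_sum_power_cong assms unfolding giuga_number_def by blast
qed

theorem proposition3:
  fixes n :: nat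
  assumes "composite n"
  shows "(giuga_number n \<longleftrightarrow> (\<forall>K>0. giuga_congruences n K)) \<and>
         ((\<forall>K>0. giuga_congruences n K) \<longleftrightarrow> (\<exists>K>0. giuga_congruences n K))"
proof -
  have "n > 0"
    using assms by (simp add: composite_def)
  have "giuga_congruences n K \<longleftrightarrow> giuga_number n" if "K > 0" for K
  proof -
    have dvd: "p - 1 dvd K * Carmichael n" "p - 1 dvd K * totient n" if "prime p" "p dvd n" for p
      using Carmichael_prime_dvd[OF that \<open>n > 0\<close>] Carmichael_dvd_totient[of n]
      by (auto intro: dvd_mult dvd_trans)
    have "giuga_number n \<longleftrightarrow> [(\<Sum>j=1..n-1. int j ^ (K * Carmichael n)) = - 1] (mod int n)"
      using assms \<open>K > 0\<close> dvd(1) by (intro giuga_number_iff_sum_power_cong) auto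
    moreover have "giuga_number n \<longleftrightarrow> [(\<Sum>j=1..n-1. int j ^ (K * totient n)) = - 1] (mod int n)"
      using assms \<open>K > 0\<close> \<open>n > 0\<close> dvd(2) by (intro giuga_number_iff_sum_power_cong) auto
    ultimately show ?thesis
      unfolding giuga_congruences_def by (meson cong_sym cong_trans)
  qed
  then show ?thesis
    \<comment> \<open>The truth of the congruences is the same for every positive \<open>K\<close>,
      so both quantifiers collapse; \<open>K = 1\<close> shows that their range is nonempty.\<close>
    by (meson zero_less_one)
qed

end
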